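(* For every $n\ge 0$, one has $|FP_n|=C_n=\frac{1}{n+1}\binom{2n}{n}$.
   Context: $I_n$ is the set of inversion sequences of length $n$, i.e. integer sequences $\sigma=(\sigma_1,\ldots,\sigma_n)$ with $0\le\sigma_i<i$ for every $1\le i\le n$ (the empty sequence is allowed, with $n=0$). For a finite integer sequence $\sigma$ of length $n$, $\Theta(\sigma)$ is the sequence of length $n$ defined by $\Theta(\sigma)_i=\#\{j<i:\sigma_j<\sigma_i\}$. $FP_n=\{\sigma\in I_n:\Theta(\sigma)=\sigma\}$. *)

theory Defs
  imports Complex_Main
begin

text \<open>
  A finite integer sequence is an \<open>int list\<close>. List indices start at 0, so the entry
  \<open>\<sigma>\<^sub>i\<close> with \<open>1 \<le> i \<le> n\<close> is \<open>s ! (i - 1)\<close>, and the bound \<open>\<sigma>\<^sub>i < i\<close> becomes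
  \<open>s ! k < int (k + 1)\<close>.
\<close>

definition inversion_seqs :: "nat \<Rightarrow> int list set" where
  "inversion_seqs n = {s. length s = n \<and> (\<forall>k<n. 0 \<le> s ! k \<and> s ! k < int (k + 1))}"

definition Theta :: "int list \<Rightarrow> int list" where
  "Theta s = map (\<lambda>i. int (card {j. j < i \<and> s ! j < s ! i})) [0..<length s]"

definition FP :: "nat \<Rightarrow> int list set" where
  "FP n = {s \<in> inversion_seqs n. Theta s = s}"

end

theory Submission
  imports Defs
begin

text \<open>
  A fixed point \<open>s\<close> of length \<open>n\<close> is extended by appending an active value, i.e. some \<open>a\<close> such that
  exactly \<open>a\<close> entries of \<open>s\<close> lie below \<open>a\<close>. As \<open>s\<close> is an inversion sequence, at least \<open>b\<close> of its
  entries lie below any \<open>b \<le> n\<close>; hence appending \<open>a\<close> destroys all active values above \<open>a\<close>, keeps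
  those up to \<open>a\<close>, and creates the single new one \<open>n + 1\<close>. So a node with \<open>k\<close> active values has
  children with \<open>2, \<dots>, k + 1\<close> active values: this is the Catalan generating tree, whose level sizes
  are ballot numbers.
\<close>

text \<open>Level sizes of the generating tree: \<open>ballot m k\<close> counts the nodes
  \<open>m\<close> levels below a node with \<open>k\<close> active values, whose
  \<open>i\<close>-th child has \<open>i + 1\<close> of them.\<close>

fun ballot :: "nat \<Rightarrow> nat \<Rightarrow> nat" where
  "ballot 0 k = 1"
| "ballot (Suc m) k = (\<Sum>i=1..k. ballot m (Suc i))"

text \<open>The classical difference of two binomials, written as a sum because subtraction on
  \<open>nat\<close> truncates. Pascal's rule drives the inner induction on
  \<open>k\<close>.\<close>

lemma ballot_Suc_add_binomial:
  "ballot (Suc m) k + ((2 * m + k + 1) choose m) = (2 * m + k + 1) choose Suc m"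
proof (induction m arbitrary: k)
  case 0
  show ?case by simp
next
  case (Suc m)
  note IH = Suc.IH
  show ?case
  proof (induction k)
    case 0
    \<comment> \<open>For \<open>k = 0\<close> the recursion sums over nothing, and the two
      binomials agree by symmetry.\<close>
    show ?case
      using binomial_symmetric[of "Suc m" "Suc (Suc (Suc (2 * m)))"] by simp
  next
    case (Suc k)
    have "ballot (Suc (Suc m)) (Suc k) = ballot (Suc (Suc m)) k + ballot (Suc m) (Suc (Suc k))"
      by (simp del: ballot.simps add: ballot.simps(2)[of "Suc m"])
    with Suc.IH IH[of "Suc (Suc k)"] show ?case
      by (simp del: ballot.simps)
  qed
qed

lemma Suc_times_ballot_1: "Suc n * ballot n 1 = (2 * n) choose n"
proof (cases n)
  case 0
  then show ?thesis by simp
next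
  case (Suc m)
  define x y where "x = Suc (Suc (2 * m)) choose m" and "y = Suc (Suc (2 * m)) choose Suc m"
  have b: "ballot (Suc m) 1 + x = y"
    using ballot_Suc_add_binomial[of m 1] unfolding x_def y_def by (simp del: ballot.simps)
  have "Suc (Suc (2 * m)) - m = Suc (Suc m)"
    by simp
  \<comment> \<open>Both sides equal \<open>(2 * m + 2) * ((2 * m + 1) choose m)\<close>.\<close>
  then have "Suc m * y = Suc (Suc m) * x"
    using binomial_absorption[of m "Suc (Suc (2 * m))"] binomial_absorb_comp[of "Suc (Suc (2 * m))" m]
    unfolding x_def y_def by (metis diff_Suc_1)
  with b have "Suc (Suc m) * ballot (Suc m) 1 = y"
    by (simp del: ballot.simps add: algebra_simps flip: b)
  then show ?thesis
    using Suc unfolding y_def by (simp del: ballot.simps)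
qed

definition count_below :: "int list \<Rightarrow> int \<Rightarrow> nat" where
  "count_below s b = card {j. j < length s \<and> s ! j < b}"

definition active :: "int list \<Rightarrow> int set" where
  "active s = {a. int (count_below s a) = a}"

lemma count_below_le_length: "count_below s b \<le> length s"
  unfolding count_below_def using card_mono[of "{..<length s}" "{j. j < length s \<and> s ! j < b}"]
  by auto

lemma count_below_snoc: "count_below (s @ [a]) b = count_below s b + (if a < b then 1 else 0)"
proof -
  have "{j. j < length (s @ [a]) \<and> (s @ [a]) ! j < b}
      = {j. j < length s \<and> s ! j < b} \<union> (if a < b then {length s} else {})"
    by (auto simp: nth_append less_Suc_eq)
  then show ?thesis
    unfolding count_below_def by (simp add: card_insert_if)
qed

lemma active_subset: "active s \<subseteq> {0..int (length s)}"
proof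
  fix a assume "a \<in> active s"
  then have "int (count_below s a) = a"
    by (simp add: active_def)
  with count_below_le_length[of s a] show "a \<in> {0..int (length s)}"
    unfolding atLeastAtMost_iff by linarith
qed

lemma finite_active: "finite (active s)"
  using active_subset finite_subset by blast

text \<open>A count of indices below \<open>i\<close> lies between 0 and \<open>i\<close>, so the
  fixed-point equations imply the bounds of an inversion sequence.\<close>

lemma FP_iff:
  "s \<in> FP n \<longleftrightarrow> length s = n \<and> (\<forall>i<n. int (card {j. j < i \<and> s ! j < s ! i}) = s ! i)"
proof -
  have "0 \<le> s ! i \<and> s ! i < int (i + 1)" if "int (card {j. j < i \<and> s ! j < s ! i}) = s ! i" for i
  proof -
    have "card {j. j < i \<and> s ! j < s ! i} \<le> i"
      using card_mono[of "{..<i}" "{j. j < i \<and> s ! j < s ! i}"] by auto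
    with that show ?thesis
      by linarith
  qed
  moreover have "Theta s = s \<longleftrightarrow> (\<forall>i<length s. int (card {j. j < i \<and> s ! j < s ! i}) = s ! i)"
    unfolding Theta_def list_eq_iff_nth_eq length_map length_upt diff_zero
    by (simp only: nth_map nth_upt length_upt diff_zero add_0 simp_thms cong: imp_cong)
  ultimately show ?thesis
    unfolding FP_def inversion_seqs_def by blast
qed

lemma FP_length: "s \<in> FP n \<Longrightarrow> length s = n"
  by (simp add: FP_def inversion_seqs_def)

lemma FP_nth_le:
  assumes "s \<in> FP n" "k < n"
  shows "s ! k \<le> int k"
proof -
  have "s ! k < int (k + 1)"
    using assms by (simp add: FP_def inversion_seqs_def)
  then show ?thesis by linarith
qed

text \<open>The equation at position \<open>i\<close> involves only entries up to
  \<open>i\<close>.\<close>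

lemma FP_take:
  assumes "s @ t \<in> FP n"
  shows "s \<in> FP (length s)"
  unfolding FP_iff
proof (intro conjI allI impI refl)
  fix i assume i: "i < length s"
  then have "{j. j < i \<and> (s @ t) ! j < (s @ t) ! i} = {j. j < i \<and> s ! j < s ! i}"
    by (auto simp: nth_append)
  moreover have "int (card {j. j < i \<and> (s @ t) ! j < (s @ t) ! i}) = (s @ t) ! i"
    using assms i unfolding FP_iff by (metis length_append trans_less_add1)
  ultimately show "int (card {j. j < i \<and> s ! j < s ! i}) = s ! i"
    using i by (simp add: nth_append)
qed

lemma FP_snoc_iff: "s @ [a] \<in> FP (Suc n) \<longleftrightarrow> s \<in> FP n \<and> a \<in> active s"
proof (cases "length s = n")
  case True
  define P where "P u i \<longleftrightarrow> int (card {j. j < i \<and> u ! j < u ! i}) = u ! i" for u :: "int list" and i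
  have "{j. j < i \<and> (s @ [a]) ! j < (s @ [a]) ! i} = {j. j < i \<and> s ! j < (s @ [a]) ! i}"
    if "i \<le> n" for i
    using that True by (auto simp: nth_append)
  note sets = this
  have "P (s @ [a]) i \<longleftrightarrow> P s i" if "i < n" for i
    using sets[of i] that True by (simp add: P_def nth_append)
  moreover have "P (s @ [a]) n \<longleftrightarrow> a \<in> active s"
    using sets[of n] True by (simp add: P_def active_def count_below_def nth_append)
  ultimately show ?thesis
    using True unfolding FP_iff P_def[symmetric] by (auto simp: less_Suc_eq)
qed (simp add: FP_iff)

text \<open>Each index \<open>j < b\<close> is counted, since \<open>s ! j \<le> j < b\<close>. For
  negative \<open>b\<close> the set \<open>{..<nat b}\<close> is empty and the bound
  trivial.\<close>

lemma count_below_ge: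
  assumes "s \<in> FP n" "b \<le> int n"
  shows "b \<le> int (count_below s b)"
proof -
  have "{..<nat b} \<subseteq> {j. j < length s \<and> s ! j < b}"
  proof
    fix j assume "j \<in> {..<nat b}"
    then have "j < n" "int j < b"
      using assms(2) by auto
    with FP_nth_le[OF assms(1), of j] show "j \<in> {j. j < length s \<and> s ! j < b}"
      using assms(1) by (auto simp: FP_length)
  qed
  from card_mono[OF _ this] show ?thesis
    by (simp add: count_below_def)
qed

lemma count_below_eq_length:
  assumes "s \<in> FP n" "b \<ge> int n"
  shows "count_below s b = n"
proof -
  have "s ! j < b" if "j < n" for j
    using FP_nth_le[OF assms(1) that] that assms(2) by linarith
  then have "{j. j < length s \<and> s ! j < b} = {..<n}"
    using assms(1) by (auto simp: FP_length)
  then show ?thesis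
    by (simp add: count_below_def)
qed

lemma active_snoc:
  assumes "s \<in> FP n" "a \<in> active s"
  shows "active (s @ [a]) = insert (int n + 1) {b \<in> active s. b \<le> a}"
proof (rule set_eqI)
  fix b
  have "a \<le> int n"
    using active_subset[of s] assms by (auto simp: FP_length)
  \<comment> \<open>If \<open>a < b \<le> n\<close>, the new count is at least \<open>b + 1\<close>,
    so \<open>b\<close> is not active. If \<open>b > n\<close>, the new count is
    \<open>n + 1\<close>, which leaves only \<open>b = n + 1\<close>.\<close>
  then show "b \<in> active (s @ [a]) \<longleftrightarrow> b \<in> insert (int n + 1) {b \<in> active s. b \<le> a}"
    using count_below_ge[OF assms(1), of b] count_below_eq_length[OF assms(1), of b]
    by (cases "b \<le> int n") (auto simp: active_def count_below_snoc)
qed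

lemma card_active_snoc:
  assumes "s \<in> FP n" "a \<in> active s"
  shows "card (active (s @ [a])) = Suc (card {b \<in> active s. b \<le> a})"
proof -
  have "int n + 1 \<notin> {b \<in> active s. b \<le> a}"
    using active_subset[of s] assms by (auto simp: FP_length)
  then show ?thesis
    using finite_active[of s] by (simp add: active_snoc[OF assms])
qed

text \<open>The ranks of the elements of \<open>A\<close> run through \<open>1, ..., card A\<close>:
  inserting a new maximum keeps the old ranks and adds the next one.\<close>

lemma sum_rank:
  fixes A :: "'a::linorder set" and g :: "nat \<Rightarrow> 'b::comm_monoid_add"
  assumes "finite A"
  shows "(\<Sum>a\<in>A. g (card {b \<in> A. b \<le> a})) = (\<Sum>i=1..card A. g i)"
  using assms
proof (induction A rule: finite_linorder_max_induct)
  case empty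
  show ?case by simp
next
  case (insert m A)
  have "m \<notin> A"
    using insert.hyps by auto
  have "{b \<in> insert m A. b \<le> a} = {b \<in> A. b \<le> a}" if "a \<in> A" for a
    using insert.hyps that by force
  moreover have "{b \<in> insert m A. b \<le> m} = insert m A"
    using insert.hyps by auto
  ultimately have "(\<Sum>a\<in>insert m A. g (card {b \<in> insert m A. b \<le> a}))
      = g (Suc (card A)) + (\<Sum>a\<in>A. g (card {b \<in> A. b \<le> a}))"
    using \<open>m \<notin> A\<close> insert.hyps by simp
  then show ?case
    using \<open>m \<notin> A\<close> insert by (simp add: add.commute)
qed

text \<open>Classifying extensions by their first new entry reproduces the recursion of
  \<open>ballot\<close>. Finiteness is carried along for the cardinality of the disjoint
  union.\<close>

lemma card_FP_extensions:
  assumes "s \<in> FP n"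
  shows "finite {t. length t = m \<and> s @ t \<in> FP (n + m)}
    \<and> card {t. length t = m \<and> s @ t \<in> FP (n + m)} = ballot m (card (active s))"
  using assms
proof (induction m arbitrary: s n)
  case 0
  then have "{t. length t = 0 \<and> s @ t \<in> FP (n + 0)} = {[]}"
    by auto
  then show ?case by simp
next
  case (Suc m)
  define E where "E a = {t. length t = m \<and> (s @ [a]) @ t \<in> FP (Suc n + m)}" for a
  have len: "length s = n"
    using Suc.prems by (rule FP_length)
  have eq: "{t. length t = Suc m \<and> s @ t \<in> FP (n + Suc m)} = (\<Union>a\<in>active s. (#) a ` E a)"
  proof -
    \<comment> \<open>The prefix \<open>s @ [a]\<close> is itself a fixed point, which forces
      \<open>a\<close> to be active.\<close>
    have "a \<in> active s" if "s @ a # t \<in> FP (Suc (n + m))" for a t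
      using FP_take[of "s @ [a]" t "Suc (n + m)"] that len by (simp add: FP_snoc_iff)
    then show ?thesis
      by (fastforce simp: E_def length_Suc_conv)
  qed
  have IH: "finite (E a) \<and> card (E a) = ballot m (Suc (card {b \<in> active s. b \<le> a}))"
    if "a \<in> active s" for a
    using Suc.IH[of "s @ [a]" "Suc n"] Suc.prems that
    unfolding E_def by (simp add: FP_snoc_iff card_active_snoc)
  have "card (\<Union>a\<in>active s. (#) a ` E a) = (\<Sum>a\<in>active s. card ((#) a ` E a))"
    using IH by (intro card_UN_disjoint finite_active) auto
  also have "\<dots> = (\<Sum>a\<in>active s. ballot m (Suc (card {b \<in> active s. b \<le> a})))"
    using IH by (intro sum.cong) (auto simp: card_image)
  also have "\<dots> = ballot (Suc m) (card (active s))"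
    using sum_rank[OF finite_active, of "\<lambda>i. ballot m (Suc i)"] by simp
  finally show ?case
    unfolding eq using IH finite_active by blast
qed

theorem theorem4p8:
  fixes n :: nat
  shows "real (card (FP n)) = 1 / (real n + 1) * real ((2 * n) choose n)"
proof -
  \<comment> \<open>The root is the empty sequence: every count is 0, so 0 is its one active
    value.\<close>
  have "[] \<in> FP 0" "active [] = {0}" "{t. length t = n \<and> [] @ t \<in> FP (0 + n)} = FP n"
    by (auto simp: FP_iff active_def count_below_def)
  with card_FP_extensions[of "[]" 0 n] have "card (FP n) = ballot n 1"
    by simp
  then have "Suc n * card (FP n) = (2 * n) choose n"
    using Suc_times_ballot_1 by simp
  then have "(real n + 1) * real (card (FP n)) = real ((2 * n) choose n)"
    by (metis of_nat_Suc of_nat_mult add.commute)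
  then show ?thesis
    by (simp add: field_simps)
qed

end
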